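(* Let $k$, $n$ and $s$ be positive integers, let $x_1,\ldots,x_n$ be independent variables, and write $E_i^{(s)}$, $H_i^{(s)}$, $P_k^{(s)}$ for these functions evaluated at $(x_1,\ldots,x_n)$. Then, summing over tuples of nonnegative integers $(t_1,\ldots,t_k)$, $$P_k^{(s)}=\sum_{t_1+2t_2+\cdots+kt_k=k}\frac{(-1)^{1+t_1+\cdots+t_k}\,k}{t_1+\cdots+t_k}\binom{t_1+\cdots+t_k}{t_1,\ldots,t_k}\prod_{i=1}^k\big(H_i^{(s)}\big)^{t_i}$$ and $$P_k^{(s)}=\sum_{t_1+2t_2+\cdots+kt_k=k}\frac{(-1)^{k+t_1+\cdots+t_k}\,k}{t_1+\cdots+t_k}\binom{t_1+\cdots+t_k}{t_1,\ldots,t_k}\prod_{i=1}^k\big(E_i^{(s)}\big)^{t_i}.$$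
   Context: For a positive integer $s$, $H_k^{(s)}$ and $E_k^{(s)}$ ($k\ge0$) are defined by the formal power series identities $$\sum_{k\ge0}H_k^{(s)}(x_1,\ldots,x_n)t^k=\prod_{i=1}^n\big(1-x_it+\cdots+(-x_it)^s\big)^{-1},\qquad \sum_{k\ge0}E_k^{(s)}(x_1,\ldots,x_n)t^k=\prod_{i=1}^n\big(1+x_it+\cdots+(x_it)^s\big).$$ $P_k^{(s)}(x_1,\ldots,x_n)=c_k^{(s)}\sum_{i=1}^n x_i^k$, where $c_k^{(s)}=(-1)^k s$ if $k\equiv0\pmod{s+1}$ and $c_k^{(s)}=(-1)^{k-1}$ otherwise. $\binom{t_1+\cdots+t_k}{t_1,\ldots,t_k}$ is the multinomial coefficient. *)

theory Defs
  imports "HOL-Computational_Algebra.Formal_Power_Series"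
    "HOL-Library.Poly_Mapping" "HOL-Library.FuncSet"
begin

text \<open>
  Polynomials over \<open>'a\<close> in countably many independent variables: a monomial is the finitely
  supported map sending the index of a variable to its exponent, and multiplication is the
  convolution product of \<^theory>\<open>HOL-Library.Poly_Mapping\<close>.
\<close>

type_synonym 'a mpoly = "(nat \<Rightarrow>\<^sub>0 nat) \<Rightarrow>\<^sub>0 'a"

definition mvar :: "nat \<Rightarrow> 'a::comm_ring_1 mpoly" where
  "mvar i = Poly_Mapping.single (Poly_Mapping.single i 1) 1"

definition mconst :: "'a::comm_ring_1 \<Rightarrow> 'a mpoly" where
  "mconst c = Poly_Mapping.single 0 c"


definition E_gen :: "nat \<Rightarrow> nat \<Rightarrow> (nat \<Rightarrow> 'r::comm_ring_1) \<Rightarrow> 'r fps" where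
  "E_gen s n x = (\<Prod>i=1..n. \<Sum>j=0..s. (fps_const (x i) * fps_X) ^ j)"

definition H_factor :: "nat \<Rightarrow> 'r::comm_ring_1 \<Rightarrow> 'r fps" where
  "H_factor s a = (\<Sum>j=0..s. (- (fps_const a * fps_X)) ^ j)"

text \<open>
  The coefficients of the power series are polynomials, so the operation \<^const>\<open>inverse\<close> on power
  series is not available; the second argument of \<open>fps_right_inverse\<close> is the inverse of the
  constant coefficient, which is 1 here.
\<close>

definition H_gen :: "nat \<Rightarrow> nat \<Rightarrow> (nat \<Rightarrow> 'r::comm_ring_1) \<Rightarrow> 'r fps" where
  "H_gen s n x = (\<Prod>i=1..n. fps_right_inverse (H_factor s (x i)) 1)"

lemma H_factor_inverse: "H_factor s a * fps_right_inverse (H_factor s a) 1 = 1"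
proof (rule fps_right_inverse)
  show "fps_nth (H_factor s a) 0 * 1 = 1"
    by (simp add: H_factor_def fps_sum_nth fps_power_zeroth power_0_left if_distrib
        cong: if_cong)
qed

definition E_fun :: "nat \<Rightarrow> nat \<Rightarrow> (nat \<Rightarrow> 'r::comm_ring_1) \<Rightarrow> nat \<Rightarrow> 'r" where
  "E_fun s n x k = fps_nth (E_gen s n x) k"

definition H_fun :: "nat \<Rightarrow> nat \<Rightarrow> (nat \<Rightarrow> 'r::comm_ring_1) \<Rightarrow> nat \<Rightarrow> 'r" where
  "H_fun s n x k = fps_nth (H_gen s n x) k"

definition P_coeff :: "nat \<Rightarrow> nat \<Rightarrow> int" where
  "P_coeff s k = (if k mod (s + 1) = 0 then (-1) ^ k * int s else (-1) ^ (k - 1))"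

definition P_fun :: "nat \<Rightarrow> nat \<Rightarrow> (nat \<Rightarrow> 'r::comm_ring_1) \<Rightarrow> nat \<Rightarrow> 'r" where
  "P_fun s n x k = of_int (P_coeff s k) * (\<Sum>i=1..n. x i ^ k)"


text \<open>Tuples \<open>(t\<^sub>1, \<dots>, t\<^sub>k)\<close> are functions extensional on \<open>{1..k}\<close>.\<close>

definition weighted_tuples :: "nat \<Rightarrow> (nat \<Rightarrow> nat) set" where
  "weighted_tuples k = {t \<in> {1..k} \<rightarrow>\<^sub>E UNIV. (\<Sum>i=1..k. i * t i) = k}"

lemma finite_weighted_tuples: "finite (weighted_tuples k)"
proof (rule finite_subset)
  show "weighted_tuples k \<subseteq> {1..k} \<rightarrow>\<^sub>E {..k}"
  proof
    fix t assume t: "t \<in> weighted_tuples k"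
    have "t i \<le> k" if i: "i \<in> {1..k}" for i
    proof -
      have "t i \<le> i * t i" using i by simp
      also have "\<dots> \<le> (\<Sum>i=1..k. i * t i)" using i by (intro member_le_sum) auto
      finally show ?thesis using t by (simp add: weighted_tuples_def)
    qed
    then show "t \<in> {1..k} \<rightarrow>\<^sub>E {..k}"
      using t by (auto simp: weighted_tuples_def PiE_iff)
  qed
qed (simp add: finite_PiE)

definition multinomial :: "nat \<Rightarrow> (nat \<Rightarrow> nat) \<Rightarrow> nat" where
  "multinomial k t = fact (\<Sum>i=1..k. t i) div (\<Prod>i=1..k. fact (t i))"

text \<open>The division of natural numbers is exact.\<close>

lemma prod_fact_dvd_fact_sum:
  fixes t :: "nat \<Rightarrow> nat" and k :: nat
  shows "(\<Prod>i=1..k. fact (t i)) dvd (fact (\<Sum>i=1..k. t i) :: nat)"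
proof (induction k)
  case (Suc k)
  have "(\<Prod>i=1..k. fact (t i)) * fact (t (Suc k)) dvd
      (fact (\<Sum>i=1..k. t i) * fact (t (Suc k)) :: nat)"
    using Suc by (rule mult_dvd_mono) simp
  also have "\<dots> dvd fact ((\<Sum>i=1..k. t i) + t (Suc k))"
    by (rule fact_fact_dvd_fact)
  finally show ?case by simp
qed simp

end

theory Submission
  imports Defs
begin

text \<open>
  If \<open>X F' = F G\<close> with \<open>F\<close> of constant term 1, then \<open>G\<close> is \<open>X F'\<close> times the inverse of \<open>F\<close>.
  The coefficients of the inverse are the sums of \<open>(-1)\<^bsup>|t|\<^esup> multinomial(t) F\<^sup>t\<close>, by the Pascal rule for
  multinomial coefficients, and removing one part \<open>i\<close> from \<open>t\<close>, with weight \<open>i\<close>, yields the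
  coefficients of \<open>G\<close> with the factor \<open>k / |t|\<close>. For the generating function of the \<open>E\<^sub>k\<close>, \<open>G\<close>
  is the sum over the variables of the logarithmic derivatives of \<open>(1 - Y\<^bsup>s + 1\<^esup>) / (1 - Y)\<close> with
  \<open>Y = x\<^sub>i X\<close>; that of the \<open>H\<^sub>k\<close> is its inverse with \<open>X\<close> replaced by \<open>-X\<close>.
\<close>

section \<open>Multinomial coefficients\<close>

lemma multinomial_mult_prod_fact:
  "multinomial k t * (\<Prod>i=1..k. fact (t i)) = fact (\<Sum>i=1..k. t i)"
  unfolding multinomial_def using prod_fact_dvd_fact_sum by (rule dvd_div_mult_self)

lemma sum_fun_upd_pred:
  fixes t :: "'b \<Rightarrow> nat" and c :: "'b \<Rightarrow> nat"
  assumes "finite I" "i \<in> I" "t i > 0"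
  shows "(\<Sum>j\<in>I. c j * t j) = (\<Sum>j\<in>I. c j * (t(i := t i - 1)) j) + c i"
proof -
  have "c i * t i = c i * (t i - 1) + c i"
    using assms(3) by (cases "t i") auto
  then show ?thesis
    using assms by (simp add: sum.remove[of I i])
qed

lemma sum_fun_upd_pred':
  fixes t :: "'b \<Rightarrow> nat"
  assumes "finite I" "i \<in> I" "t i > 0"
  shows "(\<Sum>j\<in>I. t j) = Suc (\<Sum>j\<in>I. (t(i := t i - 1)) j)"
  using sum_fun_upd_pred[of I i t "\<lambda>_. 1"] assms by simp

lemma prod_power_fun_upd_pred:
  fixes t :: "'b \<Rightarrow> nat" and a :: "'b \<Rightarrow> 'r::comm_monoid_mult"
  assumes "finite I" "i \<in> I" "t i > 0"
  shows "(\<Prod>j\<in>I. a j ^ t j) = a i * (\<Prod>j\<in>I. a j ^ (t(i := t i - 1)) j)"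
proof -
  have "a i ^ t i = a i * a i ^ (t i - 1)"
    using assms(3) by (cases "t i") auto
  then show ?thesis
    using assms by (simp add: prod.remove[of I i] mult.assoc)
qed

text \<open>After multiplication by the product of the \<open>fact (t j)\<close>, both sides become
  \<open>t i\<close> times the factorial of the sum of \<open>t\<close>; the nonzero product is then
  cancelled.\<close>

lemma multinomial_fun_upd_pred:
  assumes i: "i \<in> {1..k}" and pos: "t i > 0"
  shows "multinomial k (t(i := t i - 1)) * (\<Sum>j=1..k. t j) = t i * multinomial k t"
proof -
  define u where "u = t(i := t i - 1)"
  have sum: "(\<Sum>j=1..k. t j) = Suc (\<Sum>j=1..k. u j)"
    unfolding u_def using i pos by (intro sum_fun_upd_pred') auto
  have "(fact (t i) :: nat) = t i * fact (t i - 1)"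
    using fact_reduce[OF pos, where 'a = nat] by simp
  then have prod: "(\<Prod>j=1..k. fact (t j)) = t i * (\<Prod>j=1..k. fact (u j) :: nat)"
    using i by (simp add: u_def prod.remove[of _ i])
  have "multinomial k u * (\<Sum>j=1..k. t j) * (\<Prod>j=1..k. fact (t j)) =
      t i * (\<Sum>j=1..k. t j) * (multinomial k u * (\<Prod>j=1..k. fact (u j)))"
    unfolding prod by (simp only: ac_simps)
  also have "\<dots> = t i * fact (\<Sum>j=1..k. t j)"
    unfolding multinomial_mult_prod_fact sum fact_Suc by (simp add: algebra_simps)
  also have "\<dots> = t i * multinomial k t * (\<Prod>j=1..k. fact (t j))"
    by (simp only: multinomial_mult_prod_fact [symmetric] mult.assoc)
  finally show ?thesis
    by (simp add: u_def)
qed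

text \<open>Weight \<open>w i = 1\<close> gives the right-hand side of the Pascal rule. Weight
  \<open>w i = i\<close> gives the number k / |t| * multinomial(t) of the theorem, here visibly an
  integer, so that the argument runs in any commutative ring. Indices with \<open>t i = 0\<close>
  are left out because truncated subtraction would keep \<open>t\<close> unchanged there.\<close>

definition pred_multinomial_sum :: "(nat \<Rightarrow> nat) \<Rightarrow> nat \<Rightarrow> (nat \<Rightarrow> nat) \<Rightarrow> nat" where
  "pred_multinomial_sum w k t =
     (\<Sum>i | i \<in> {1..k} \<and> t i > 0. w i * multinomial k (t(i := t i - 1)))"

lemma pred_multinomial_sum_mult:
  "pred_multinomial_sum w k t * (\<Sum>j=1..k. t j) = (\<Sum>i=1..k. w i * t i) * multinomial k t"
proof -
  have "pred_multinomial_sum w k t * (\<Sum>j=1..k. t j) =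
      (\<Sum>i | i \<in> {1..k} \<and> t i > 0. w i * t i * multinomial k t)"
    unfolding pred_multinomial_sum_def sum_distrib_right
    by (intro sum.cong refl) (simp only: mult.assoc mem_Collect_eq multinomial_fun_upd_pred)
  also have "\<dots> = (\<Sum>i=1..k. w i * t i * multinomial k t)"
    by (intro sum.mono_neutral_left) auto
  finally show ?thesis
    by (simp add: sum_distrib_right)
qed

section \<open>Sums over weighted tuples\<close>

text \<open>The weight \<open>m\<close> is separate from the index range \<open>{1..k}\<close>:
  taking off a part \<open>i\<close> lowers the weight but must not change the domain of the
  tuple.\<close>

definition bounded_tuples :: "nat \<Rightarrow> nat \<Rightarrow> (nat \<Rightarrow> nat) set" where
  "bounded_tuples k m = {t \<in> {1..k} \<rightarrow>\<^sub>E UNIV. (\<Sum>i=1..k. i * t i) = m}"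

lemma weighted_tuples_eq: "weighted_tuples k = bounded_tuples k k"
  by (simp add: weighted_tuples_def bounded_tuples_def)

lemma finite_bounded_tuples: "finite (bounded_tuples k m)"
proof (rule finite_subset)
  show "bounded_tuples k m \<subseteq> {1..k} \<rightarrow>\<^sub>E {..m}"
  proof
    fix t assume t: "t \<in> bounded_tuples k m"
    have "t i \<le> m" if i: "i \<in> {1..k}" for i
    proof -
      have "t i \<le> i * t i" using i by simp
      also have "\<dots> \<le> (\<Sum>i=1..k. i * t i)" using i by (intro member_le_sum) auto
      finally show ?thesis using t by (simp add: bounded_tuples_def)
    qed
    then show "t \<in> {1..k} \<rightarrow>\<^sub>E {..m}"
      using t by (auto simp: bounded_tuples_def PiE_iff)
  qed
qed (simp add: finite_PiE)

lemma sum_bounded_tuples_pos: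
  assumes "t \<in> bounded_tuples k m" "m > 0"
  shows "(\<Sum>i=1..k. t i) > 0"
proof (rule ccontr)
  assume "\<not> (\<Sum>i=1..k. t i) > 0"
  then have "(\<Sum>i=1..k. i * t i) = 0"
    by simp
  then show False
    using assms by (simp add: bounded_tuples_def)
qed

lemma bounded_tuples_0: "bounded_tuples k 0 = {\<lambda>i\<in>{1..k}. 0}"
  by (auto simp: bounded_tuples_def PiE_iff extensional_def fun_eq_iff)

lemma bij_betw_pred_tuple:
  assumes i: "i \<in> {1..k}" and "i \<le> m"
  shows "bij_betw (\<lambda>t. t(i := t i - 1)) {t \<in> bounded_tuples k m. t i > 0}
           (bounded_tuples k (m - i))"
proof (rule bij_betw_byWitness[where f' = "\<lambda>t. t(i := t i + 1)"])
  show "(\<lambda>t. t(i := t i - 1)) ` {t \<in> bounded_tuples k m. t i > 0} \<subseteq> bounded_tuples k (m - i)"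
  proof safe
    fix t assume t: "t \<in> bounded_tuples k m" "t i > 0"
    have "(\<Sum>j=1..k. j * t j) = (\<Sum>j=1..k. j * (t(i := t i - 1)) j) + i"
      using i t(2) by (intro sum_fun_upd_pred) auto
    then show "t(i := t i - 1) \<in> bounded_tuples k (m - i)"
      using t i by (auto simp: bounded_tuples_def PiE_iff extensional_def simp del: fun_upd_apply)
        (auto simp: bounded_tuples_def PiE_iff extensional_def)
  qed
  show "(\<lambda>t. t(i := t i + 1)) ` bounded_tuples k (m - i) \<subseteq> {t \<in> bounded_tuples k m. t i > 0}"
  proof safe
    fix t assume t: "t \<in> bounded_tuples k (m - i)"
    \<comment> \<open>\<open>sum_fun_upd_pred\<close> is applied to the raised tuple; lowering it
      again gives back \<open>t\<close>.\<close>
    have "(\<Sum>j=1..k. j * (t(i := t i + 1)) j) =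
        (\<Sum>j=1..k. j * ((t(i := t i + 1))(i := (t(i := t i + 1)) i - 1)) j) + i"
      using i by (intro sum_fun_upd_pred) auto
    then have "(\<Sum>j=1..k. j * (t(i := t i + 1)) j) = (\<Sum>j=1..k. j * t j) + i"
      by simp
    then show "t(i := t i + 1) \<in> bounded_tuples k m"
      using t i assms(2)
      by (auto simp: bounded_tuples_def PiE_iff extensional_def simp del: fun_upd_apply)
        (auto simp: bounded_tuples_def PiE_iff extensional_def)
  qed auto
qed auto

section \<open>Coefficients of the inverse of a power series\<close>

text \<open>This is the coefficient of X^m in the inverse of 1 + a_1 X + ... + a_k X^k, obtained by
  expanding the geometric series with the multinomial theorem.\<close>

definition inverse_coeff :: "(nat \<Rightarrow> 'r::comm_ring_1) \<Rightarrow> nat \<Rightarrow> nat \<Rightarrow> 'r" where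
  "inverse_coeff a k m = (\<Sum>t\<in>bounded_tuples k m.
     (-1) ^ (\<Sum>i=1..k. t i) * of_nat (multinomial k t) * (\<Prod>i=1..k. a i ^ t i))"

text \<open>After exchanging the sums over \<open>t\<close> and \<open>i\<close>, lowering
  \<open>t i\<close> is a bijection onto the tuples of weight \<open>m - i\<close> and splits off
  the factor \<open>- a i\<close>. Parts larger than \<open>m\<close> cannot occur. The weight
  \<open>w\<close> is arbitrary because both the constant 1 and the identity are needed.\<close>

lemma sum_pred_multinomial_sum:
  fixes a :: "nat \<Rightarrow> 'r::comm_ring_1"
  assumes "m \<le> k"
  shows "(\<Sum>t\<in>bounded_tuples k m. (-1) ^ (\<Sum>i=1..k. t i) *
             of_nat (pred_multinomial_sum w k t) * (\<Prod>i=1..k. a i ^ t i)) =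
         - (\<Sum>i=1..m. of_nat (w i) * a i * inverse_coeff a k (m - i))"
proof -
  define M where "M = (\<lambda>t. (-1) ^ (\<Sum>i=1..k. t i) * of_nat (multinomial k t) *
    (\<Prod>i=1..k. a i ^ t i))"
  have step: "(-1) ^ (\<Sum>i=1..k. t i) * of_nat (w i * multinomial k (t(i := t i - 1))) *
      (\<Prod>i=1..k. a i ^ t i) = - (of_nat (w i) * a i * M (t(i := t i - 1)))"
    if "i \<in> {1..k}" "t i > 0" for i t
  proof -
    define u where "u = t(i := t i - 1)"
    have "(\<Sum>i=1..k. t i) = Suc (\<Sum>i=1..k. u i)"
      unfolding u_def using that by (intro sum_fun_upd_pred') auto
    moreover have "(\<Prod>i=1..k. a i ^ t i) = a i * (\<Prod>i=1..k. a i ^ u i)"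
      unfolding u_def using that by (intro prod_power_fun_upd_pred) auto
    ultimately show ?thesis
      by (simp add: M_def u_def [symmetric] mult_ac del: fun_upd_apply One_nat_def)
  qed
  have small: "{t \<in> bounded_tuples k m. t i > 0} = {}" if "i \<in> {1..k}" "i > m" for i
  proof -
    have False if t: "t \<in> bounded_tuples k m" "t i > 0" for t
    proof -
      have "i \<le> i * t i" using t by simp
      also have "\<dots> \<le> (\<Sum>i=1..k. i * t i)"
        using \<open>i \<in> {1..k}\<close> by (intro member_le_sum) auto
      finally show False
        using t \<open>i > m\<close> by (simp add: bounded_tuples_def)
    qed
    then show ?thesis by blast
  qed
  have "(\<Sum>t\<in>bounded_tuples k m. (-1) ^ (\<Sum>i=1..k. t i) *
             of_nat (pred_multinomial_sum w k t) * (\<Prod>i=1..k. a i ^ t i)) =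
      (\<Sum>t\<in>bounded_tuples k m. \<Sum>i | i \<in> {1..k} \<and> t i > 0.
         - (of_nat (w i) * a i * M (t(i := t i - 1))))"
    unfolding pred_multinomial_sum_def of_nat_sum sum_distrib_left sum_distrib_right
    by (intro sum.cong refl step) auto
  also have "\<dots> = (\<Sum>i=1..k. \<Sum>t | t \<in> bounded_tuples k m \<and> t i > 0.
         - (of_nat (w i) * a i * M (t(i := t i - 1))))"
    by (intro sum.swap_restrict finite_bounded_tuples) auto
  also have "\<dots> = (\<Sum>i=1..m. \<Sum>t | t \<in> bounded_tuples k m \<and> t i > 0.
         - (of_nat (w i) * a i * M (t(i := t i - 1))))"
    using assms by (intro sum.mono_neutral_right) (auto simp: small simp del: neq0_conv)
  also have "\<dots> = (\<Sum>i=1..m. - (of_nat (w i) * a i * inverse_coeff a k (m - i)))"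
  proof (rule sum.cong [OF refl])
    fix i assume i: "i \<in> {1..m}"
    have "(\<Sum>t | t \<in> bounded_tuples k m \<and> t i > 0. M (t(i := t i - 1))) =
        (\<Sum>t\<in>bounded_tuples k (m - i). M t)"
      using i assms by (intro sum.reindex_bij_betw bij_betw_pred_tuple) auto
    then show "(\<Sum>t | t \<in> bounded_tuples k m \<and> t i > 0.
        - (of_nat (w i) * a i * M (t(i := t i - 1)))) =
        - (of_nat (w i) * a i * inverse_coeff a k (m - i))"
      by (simp add: sum_negf sum_distrib_left [symmetric] inverse_coeff_def M_def)
  qed
  finally show ?thesis
    by (simp add: sum_negf)
qed

lemma inverse_coeff_0: "inverse_coeff a k 0 = 1"
  by (simp add: inverse_coeff_def bounded_tuples_0 multinomial_def)

text \<open>This is the case \<open>w = 1\<close>, where the Pascal rule applies. Positivity of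
  \<open>m\<close> makes the sum of \<open>t\<close> nonzero, so it can be cancelled in
  \<open>pred_multinomial_sum_mult\<close>.\<close>

lemma inverse_coeff_rec:
  assumes "m > 0" "m \<le> k"
  shows "inverse_coeff a k m = - (\<Sum>i=1..m. a i * inverse_coeff a k (m - i))"
proof -
  have "pred_multinomial_sum (\<lambda>_. 1) k t = multinomial k t" if "t \<in> bounded_tuples k m" for t
    using pred_multinomial_sum_mult[of "\<lambda>_. 1" k t] sum_bounded_tuples_pos[OF that assms(1)]
    by (simp add: mult.commute del: sum_eq_0_iff)
  then have "inverse_coeff a k m = (\<Sum>t\<in>bounded_tuples k m. (-1) ^ (\<Sum>i=1..k. t i) *
             of_nat (pred_multinomial_sum (\<lambda>_. 1) k t) * (\<Prod>i=1..k. a i ^ t i))"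
    unfolding inverse_coeff_def by (intro sum.cong refl) simp
  then show ?thesis
    using sum_pred_multinomial_sum[OF assms(2), of "\<lambda>_. 1" a] by simp
qed

text \<open>Comparing coefficients in \<open>F * C = 1\<close> yields the recursion of
  \<open>inverse_coeff_rec\<close>, so strong induction on \<open>m\<close> identifies the two
  sequences.\<close>

lemma fps_nth_inverse_eq_inverse_coeff:
  fixes F C :: "'r::comm_ring_1 fps"
  assumes FC: "F * C = 1" and F0: "fps_nth F 0 = 1" and "m \<le> k"
  shows "fps_nth C m = inverse_coeff (fps_nth F) k m"
  using \<open>m \<le> k\<close>
proof (induction m rule: less_induct)
  case (less m)
  show ?case
  proof (cases "m = 0")
    case True
    have "fps_nth (F * C) 0 = 1"
      using FC by simp
    then show ?thesis
      using F0 True by (simp add: inverse_coeff_0)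
  next
    case False
    have "(\<Sum>i=0..m. fps_nth F i * fps_nth C (m - i)) = fps_nth (F * C) m"
      by (simp add: fps_mult_nth)
    also have "\<dots> = 0"
      using False by (simp add: FC)
    finally have "fps_nth C m + (\<Sum>i=1..m. fps_nth F i * fps_nth C (m - i)) = 0"
      using F0 by (simp add: sum.atLeast_Suc_atMost)
    moreover have "(\<Sum>i=1..m. fps_nth F i * fps_nth C (m - i)) =
        (\<Sum>i=1..m. fps_nth F i * inverse_coeff (fps_nth F) k (m - i))"
      using less by (intro sum.cong) auto
    ultimately show ?thesis
      using False less.prems by (simp add: inverse_coeff_rec add_eq_0_iff2)
  qed
qed

text \<open>With \<open>C\<close> the inverse of \<open>F\<close>, \<open>G\<close> is X F' C. The
  factor \<open>i\<close> in the coefficients of X F' is the weight \<open>w i = i\<close> in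
  \<open>sum_pred_multinomial_sum\<close>.\<close>

lemma fps_nth_log_deriv:
  fixes F G :: "'r::comm_ring_1 fps"
  assumes FG: "fps_X * fps_deriv F = F * G" and F0: "fps_nth F 0 = 1"
  shows "fps_nth G k = (\<Sum>t\<in>weighted_tuples k. (-1) ^ (1 + (\<Sum>i=1..k. t i)) *
           of_nat (pred_multinomial_sum (\<lambda>i. i) k t) * (\<Prod>i=1..k. fps_nth F i ^ t i))"
proof -
  define C where "C = fps_right_inverse F 1"
  have FC: "F * C = 1"
    unfolding C_def using F0 by (intro fps_right_inverse) simp
  have "G = fps_X * fps_deriv F * C"
    using FC unfolding FG by (simp add: mult_ac) (simp add: mult.assoc [symmetric] FC)
  then have "fps_nth G k = (\<Sum>i=0..k. fps_nth (fps_X * fps_deriv F) i * fps_nth C (k - i))"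
    by (simp add: fps_mult_nth)
  \<comment> \<open>The term with index 0 drops out because X F' has no constant term.\<close>
  also have "\<dots> = (\<Sum>i=1..k. of_nat i * fps_nth F i * inverse_coeff (fps_nth F) k (k - i))"
    unfolding sum.atLeast_Suc_atMost[OF le0]
    by (auto intro!: sum.cong simp: fps_nth_inverse_eq_inverse_coeff[OF FC F0, of _ k])
  also have "\<dots> = - (\<Sum>t\<in>bounded_tuples k k. (-1) ^ (\<Sum>i=1..k. t i) *
           of_nat (pred_multinomial_sum (\<lambda>i. i) k t) * (\<Prod>i=1..k. fps_nth F i ^ t i))"
    by (simp only: sum_pred_multinomial_sum[OF order_refl] minus_minus)
  finally show ?thesis
    by (simp add: weighted_tuples_eq sum_negf)
qed

section \<open>Logarithmic derivatives of the generating functions\<close>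

lemma fps_nth_prod_0:
  fixes F :: "'b \<Rightarrow> 'r::comm_ring_1 fps"
  shows "fps_nth (\<Prod>i\<in>I. F i) 0 = (\<Prod>i\<in>I. fps_nth (F i) 0)"
  by (induction I rule: infinite_finite_induct) auto

lemma log_deriv_mult:
  fixes F1 F2 :: "'r::comm_ring_1 fps"
  assumes "fps_X * fps_deriv F1 = F1 * G1" "fps_X * fps_deriv F2 = F2 * G2"
  shows "fps_X * fps_deriv (F1 * F2) = F1 * F2 * (G1 + G2)"
proof -
  have "fps_X * fps_deriv (F1 * F2) = F1 * (fps_X * fps_deriv F2) + fps_X * fps_deriv F1 * F2"
    by (simp add: algebra_simps)
  then show ?thesis
    by (simp add: assms algebra_simps)
qed

lemma log_deriv_prod:
  fixes F G :: "'b \<Rightarrow> 'r::comm_ring_1 fps"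
  assumes "finite I" "\<And>i. i \<in> I \<Longrightarrow> fps_X * fps_deriv (F i) = F i * G i"
  shows "fps_X * fps_deriv (\<Prod>i\<in>I. F i) = (\<Prod>i\<in>I. F i) * (\<Sum>i\<in>I. G i)"
  using assms by (induction I) (auto intro: log_deriv_mult simp del: fps_deriv_mult)

text \<open>The identity follows by differentiating \<open>F * C = 1\<close> and multiplying by X
  C.\<close>

lemma log_deriv_inverse:
  fixes F C G :: "'r::comm_ring_1 fps"
  assumes FG: "fps_X * fps_deriv F = F * G" and FC: "F * C = 1"
  shows "fps_X * fps_deriv C = C * (- G)"
proof -
  have "fps_deriv (F * C) = 0"
    by (simp add: FC)
  then have "C * (fps_X * (F * fps_deriv C + fps_deriv F * C)) = 0"
    by simp
  then have "(F * C) * (fps_X * fps_deriv C) + C * (fps_X * fps_deriv F) * C = 0"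
    by (simp add: algebra_simps)
  moreover have "C * (F * G) * C = (F * C) * (C * G)"
    by (simp only: ac_simps)
  ultimately have "fps_X * fps_deriv C + C * G = 0"
    by (simp only: FG FC mult_1_left)
  then show ?thesis
    by (simp add: eq_neg_iff_add_eq_0)
qed

section \<open>Logarithmic derivative of a truncated geometric series\<close>

text \<open>These are the coefficients of Y/(1 - Y) - (s+1) Y^(s+1)/(1 - Y^(s+1)), which is Y times
  the logarithmic derivative of 1 + Y + ... + Y^s.\<close>

definition geom_coeff :: "nat \<Rightarrow> nat \<Rightarrow> int" where
  "geom_coeff s k = (if k = 0 then 0 else if (s + 1) dvd k then - int s else 1)"

lemma sum_geom_coeff_le:
  assumes "k \<le> s"
  shows "(\<Sum>j=0..k. geom_coeff s j) = int k"
proof -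
  have "(\<Sum>j=0..k. geom_coeff s j) = (\<Sum>j=1..k. 1)"
    unfolding sum.atLeast_Suc_atMost[OF le0] One_nat_def geom_coeff_def if_P[OF refl] add_0_left
    using assms by (intro sum.cong) (auto dest: dvd_imp_le)
  then show ?thesis by simp
qed

text \<open>Among s + 1 consecutive positive indices exactly one is a multiple of s + 1, and its
  value -s cancels the s ones. The induction shifts the window by one: the entering and the leaving
  value agree by periodicity.\<close>

lemma sum_geom_coeff_window: "(\<Sum>j=0..s. geom_coeff s (Suc m + j)) = 0"
proof (induction m)
  case 0
  \<comment> \<open>Index 0 may be included since \<open>geom_coeff s 0 = 0\<close>.\<close>
  have "(\<Sum>j=0..Suc s. geom_coeff s j) = int s + geom_coeff s (Suc s)"
    by (simp add: sum_geom_coeff_le)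
  also have "\<dots> = 0" by (simp add: geom_coeff_def)
  finally show ?case
    by (simp only: sum.atLeast0_atMost_Suc_shift) (simp add: geom_coeff_def)
next
  case (Suc m)
  have "geom_coeff s (Suc m + Suc s) = geom_coeff s (Suc m)"
    using dvd_add_left_iff[of "s + 1" "Suc s" "Suc m"] by (simp add: geom_coeff_def)
  moreover have "(\<Sum>j=0..s. geom_coeff s (Suc m + j)) + geom_coeff s (Suc m + Suc s) =
      geom_coeff s (Suc m) + (\<Sum>j=0..s. geom_coeff s (Suc (Suc m) + j))"
    using sum.atLeast0_atMost_Suc[of "\<lambda>j. geom_coeff s (Suc m + j)" s]
      sum.atLeast0_atMost_Suc_shift[of "\<lambda>j. geom_coeff s (Suc m + j)" s]
    by simp
  ultimately show ?case
    using Suc by simp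
qed

lemma fps_nth_geom_sum:
  fixes a :: "'r::comm_ring_1"
  shows "fps_nth (\<Sum>j=0..s. (fps_const a * fps_X) ^ j) k = (if k \<le> s then a ^ k else 0)"
  by (simp add: fps_sum_nth power_mult_distrib fps_const_power fps_X_power_nth if_distrib
      cong: if_cong)

text \<open>Up to the factor \<open>a ^ k\<close>, coefficient \<open>k\<close> of the product sums
  \<open>geom_coeff\<close> over the last min(k, s) + 1 indices ending at \<open>k\<close>. For k
  \<le> s this gives \<open>k\<close>, as in X F'; beyond that it is a full window and
  vanishes.\<close>

lemma log_deriv_geom_sum:
  fixes a :: "'r::comm_ring_1" and s :: nat
  defines "F \<equiv> (\<Sum>j=0..s. (fps_const a * fps_X) ^ j)"
  shows "fps_X * fps_deriv F = F * Abs_fps (\<lambda>k. of_int (geom_coeff s k) * a ^ k)"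
proof (rule fps_ext)
  fix k
  have "fps_nth (F * Abs_fps (\<lambda>k. of_int (geom_coeff s k) * a ^ k)) k =
      (\<Sum>j=0..k. (if j \<le> s then a ^ j else 0) * (of_int (geom_coeff s (k - j)) * a ^ (k - j)))"
    by (simp add: fps_mult_nth F_def fps_nth_geom_sum)
  also have "\<dots> = (\<Sum>j=0..min k s. of_int (geom_coeff s (k - j)) * a ^ k)"
    by (intro sum.mono_neutral_cong_right)
      (auto simp: mult.left_commute[of "a ^ j" "of_int _" for j] simp flip: power_add)
  also have "\<dots> = of_int (\<Sum>j=0..min k s. geom_coeff s (k - j)) * a ^ k"
    by (simp add: sum_distrib_right)
  also have "(\<Sum>j=0..min k s. geom_coeff s (k - j)) = (if k \<le> s then int k else 0)"
  proof (cases "k \<le> s")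
    case True
    have "(\<Sum>j=0..k. geom_coeff s (k - j)) = (\<Sum>j=0..k. geom_coeff s j)"
      using sum.atLeastAtMost_rev[of "geom_coeff s" 0 k] by simp
    then show ?thesis
      using True by (simp add: sum_geom_coeff_le min_def)
  next
    case False
    \<comment> \<open>The window k - s, ..., k starts at \<open>Suc m\<close>, which is positive as
      \<open>sum_geom_coeff_window\<close> demands.\<close>
    define m where "m = k - Suc s"
    have k: "k = Suc m + s"
      using False by (simp add: m_def)
    have "(\<Sum>j=0..s. geom_coeff s (k - j)) = (\<Sum>j=0..s. geom_coeff s (Suc m + (s - j)))"
      by (intro sum.cong) (auto simp: k Suc_diff_le)
    also have "\<dots> = (\<Sum>j=0..s. geom_coeff s (Suc m + j))"
      using sum.atLeastAtMost_rev[of "\<lambda>j. geom_coeff s (Suc m + j)" 0 s] by simp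
    finally show ?thesis
      using False by (simp only: sum_geom_coeff_window) simp
  qed
  also have "of_int (if k \<le> s then int k else 0) * a ^ k = fps_nth (fps_X * fps_deriv F) k"
    by (cases k) (auto simp: F_def fps_nth_geom_sum)
  finally show "fps_nth (fps_X * fps_deriv F) k =
      fps_nth (F * Abs_fps (\<lambda>k. of_int (geom_coeff s k) * a ^ k)) k" ..
qed

section \<open>The generating functions of E and H\<close>

lemma log_deriv_E_gen:
  "fps_X * fps_deriv (E_gen s n x) =
     E_gen s n x * (\<Sum>i=1..n. Abs_fps (\<lambda>k. of_int (geom_coeff s k) * x i ^ k))"
  unfolding E_gen_def by (intro log_deriv_prod log_deriv_geom_sum) auto

text \<open>Each factor is the inverse of a truncated geometric series in -x_i X: the inversion
  gives the outer minus sign, the substitution the inner one.\<close>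

lemma log_deriv_H_gen:
  "fps_X * fps_deriv (H_gen s n x) =
     H_gen s n x * (\<Sum>i=1..n. - Abs_fps (\<lambda>k. of_int (geom_coeff s k) * (- x i) ^ k))"
proof -
  have "H_factor s a = (\<Sum>j=0..s. (fps_const (- a) * fps_X) ^ j)" for a :: 'a
    by (simp add: H_factor_def fps_const_neg [symmetric] del: fps_const_neg)
  then show ?thesis
    unfolding H_gen_def
    by (intro log_deriv_prod log_deriv_inverse[OF _ H_factor_inverse])
      (auto intro: log_deriv_geom_sum)
qed

lemma fps_nth_E_gen_0: "fps_nth (E_gen s n x) 0 = 1"
  by (simp add: E_gen_def fps_nth_prod_0 fps_nth_geom_sum)

lemma fps_nth_H_gen_0: "fps_nth (H_gen s n x) 0 = 1"
  unfolding H_gen_def by (simp add: fps_nth_prod_0)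

text \<open>The index 0 is excluded: there \<open>geom_coeff\<close> is 0, whereas
  \<open>P_coeff\<close> is s.\<close>

lemma geom_coeff_eq_P_coeff:
  assumes "k \<ge> 1"
  shows "P_coeff s k = (-1) ^ (k + 1) * geom_coeff s k"
  using assms by (cases k) (auto simp: P_coeff_def geom_coeff_def mod_eq_0_iff_dvd)

text \<open>The two minus signs together produce the sign \<open>(-1) ^ (k + 1)\<close> relating
  \<open>P_coeff\<close> to \<open>geom_coeff\<close>, so no sign remains in front.\<close>

lemma P_fun_eq_H_log_deriv:
  assumes "k \<ge> 1"
  shows "P_fun s n x k =
    fps_nth (\<Sum>i=1..n. - Abs_fps (\<lambda>k. of_int (geom_coeff s k) * (- x i) ^ k)) k"
proof -
  have "of_int (geom_coeff s k) * (- a) ^ k = - (of_int (P_coeff s k) * a ^ k)" for a :: 'a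
    using power_minus[of a k] by (simp add: geom_coeff_eq_P_coeff[OF assms] mult_ac)
  then show ?thesis
    by (simp add: P_fun_def fps_sum_nth sum_distrib_left)
qed

lemma P_fun_eq_E_log_deriv:
  assumes "k \<ge> 1"
  shows "P_fun s n x k = (-1) ^ (k + 1) *
    fps_nth (\<Sum>i=1..n. Abs_fps (\<lambda>k. of_int (geom_coeff s k) * x i ^ k)) k"
  by (simp add: P_fun_def geom_coeff_eq_P_coeff[OF assms] fps_sum_nth sum_distrib_left mult.assoc)

text \<open>This links the fractions in the theorem, formed in the field of coefficients, to the
  division-free \<open>pred_multinomial_sum\<close>. In characteristic 0 the positive denominator is
  nonzero.\<close>

lemma mconst_mult_of_nat_div:
  assumes t: "t \<in> weighted_tuples k" and "k \<ge> 1"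
  shows "mconst ((-1) ^ e * of_nat k / of_nat (\<Sum>i=1..k. t i) * of_nat (multinomial k t)) =
    ((-1) ^ e * of_nat (pred_multinomial_sum (\<lambda>i. i) k t) :: 'a::field_char_0 mpoly)"
proof -
  have pos: "(\<Sum>i=1..k. t i) > 0"
    using t assms(2) by (intro sum_bounded_tuples_pos) (auto simp: weighted_tuples_eq)
  have "pred_multinomial_sum (\<lambda>i. i) k t * (\<Sum>i=1..k. t i) = k * multinomial k t"
    using t pred_multinomial_sum_mult[of "\<lambda>i. i" k t] by (simp add: weighted_tuples_def)
  then have "of_nat k * of_nat (multinomial k t) =
      (of_nat (pred_multinomial_sum (\<lambda>i. i) k t) * of_nat (\<Sum>i=1..k. t i) :: 'a)"
    by (simp only: of_nat_mult [symmetric])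
  \<comment> \<open>The quotient is written as an embedded integer so that
    \<open>single_of_int\<close> can carry it into the polynomial ring.\<close>
  then have "(-1) ^ e * of_nat k / of_nat (\<Sum>i=1..k. t i) * of_nat (multinomial k t) =
      (of_int ((-1) ^ e * int (pred_multinomial_sum (\<lambda>i. i) k t)) :: 'a)"
    using pos by (simp add: divide_simps del: of_nat_sum sum_eq_0_iff)
  then show ?thesis
    by (simp only: mconst_def single_of_int) simp
qed

theorem theorem2p6:
  fixes k n s :: nat
  assumes "k \<ge> 1" and "n \<ge> 1" and "s \<ge> 1"
  shows "(P_fun s n mvar k :: 'a::field_char_0 mpoly) =
      (\<Sum>t\<in>weighted_tuples k.
         mconst ((-1) ^ (1 + (\<Sum>i=1..k. t i)) * of_nat k / of_nat (\<Sum>i=1..k. t i)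
                 * of_nat (multinomial k t))
         * (\<Prod>i=1..k. H_fun s n mvar i ^ t i)) \<and>
    (P_fun s n mvar k :: 'a mpoly) =
      (\<Sum>t\<in>weighted_tuples k.
         mconst ((-1) ^ (k + (\<Sum>i=1..k. t i)) * of_nat k / of_nat (\<Sum>i=1..k. t i)
                 * of_nat (multinomial k t))
         * (\<Prod>i=1..k. E_fun s n mvar i ^ t i))"
proof (intro conjI)
  show "(P_fun s n mvar k :: 'a mpoly) = (\<Sum>t\<in>weighted_tuples k.
         mconst ((-1) ^ (1 + (\<Sum>i=1..k. t i)) * of_nat k / of_nat (\<Sum>i=1..k. t i)
                 * of_nat (multinomial k t))
         * (\<Prod>i=1..k. H_fun s n mvar i ^ t i))"
    unfolding P_fun_eq_H_log_deriv[OF assms(1)]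
      fps_nth_log_deriv[OF log_deriv_H_gen fps_nth_H_gen_0] H_fun_def
    by (intro sum.cong refl arg_cong2[where f = "(*)"] mconst_mult_of_nat_div[symmetric] assms(1))
next
  \<comment> \<open>The sign left over in \<open>P_fun_eq_E_log_deriv\<close> turns the exponent 1 +
    |t| into k + |t|, the only difference between the two formulas besides the functions
    themselves.\<close>
  have sign: "(-1) ^ (k + 1) * ((-1) ^ (1 + m) * c * d) = (-1) ^ (k + m) * c * (d :: 'a mpoly)"
    for m c d
    by (simp add: power_add mult_ac)
  show "(P_fun s n mvar k :: 'a mpoly) = (\<Sum>t\<in>weighted_tuples k.
         mconst ((-1) ^ (k + (\<Sum>i=1..k. t i)) * of_nat k / of_nat (\<Sum>i=1..k. t i)
                 * of_nat (multinomial k t))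
         * (\<Prod>i=1..k. E_fun s n mvar i ^ t i))"
    unfolding P_fun_eq_E_log_deriv[OF assms(1)]
      fps_nth_log_deriv[OF log_deriv_E_gen fps_nth_E_gen_0] E_fun_def sum_distrib_left sign
    by (intro sum.cong refl arg_cong2[where f = "(*)"] mconst_mult_of_nat_div[symmetric] assms(1))
qed

end
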